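(* Let $c_m,s_m$ be the polynomials defined below, and $S,\hat S$ the sums defined below. Let $i\in\mathbb N=\{1,2,\dots\}$. (i) For $m\in\mathbb N_0$ and $l=1,\dots,i$: $$c_m\!\left(\tfrac{(2l-1)\pi}{2i+1}\right)=\frac{(-1)^mB_{2m+2}\pi^{2m+2}}{(2m+2)!}\left(2^{2m+1}\Big(1+\frac{1}{(2i+1)^{2m+2}}\Big)-1\right)+\sum_{j=1}^{i}(-1)^j\cos\!\left(\tfrac{j(2l-1)\pi}{2i+1}\right)S(2m+2,2i+1,j).$$ (ii) For $m\in\mathbb N_0$ and $l=1,\dots,i$: $$c_m\!\left(\tfrac{(2l-1)\pi}{2i}\right)=\frac{\pi^{2m+2}(-1)^mB_{2m+2}(2^{2m+1}-1)}{(2m+2)!}\left(1-(2i)^{-2m-2}\right)+\sum_{j=1}^{i-1}(-1)^j\cos\!\left(\tfrac{(2l-1)j\pi}{2i}\right)\hat S(2m+2,2i,j).$$ (iii) For $m\in\mathbb N_0$ and $l=1,\dots,i$: $$c_m\!\left(\tfrac{2l\pi}{2i+1}\right)=\frac{\pi^{2m+2}(-1)^mB_{2m+2}(2^{2m+1}-1)}{(2m+2)!}\left(1-(2i+1)^{-2m-2}\right)+\sum_{j=1}^{i}(-1)^j\cos\!\left(\tfrac{2lj\pi}{2i+1}\right)\hat S(2m+2,2i+1,j).$$ (iv) For $m\in\mathbb N$ and $l=1,\dots,i$: $$s_m\!\left(\tfrac{(2l-1)\pi}{2i+1}\right)=\sum_{j=1}^{i}(-1)^j\sin\!\left(\tfrac{(2l-1)j\pi}{2i+1}\right)S(2m+1,2i+1,j).$$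 (v) For $m\in\mathbb N$ and $l=1,\dots,i$: $$s_m\!\left(\tfrac{(2l-1)\pi}{2i}\right)=(-1)^{i+l+1}\frac{1}{i^{2m+1}}S(2m+1,4,1)+\sum_{j=1}^{i-1}(-1)^j\sin\!\left(\tfrac{(2l-1)j\pi}{2i}\right)\hat S(2m+1,2i,j).$$ (vi) For $m\in\mathbb N$ and $l=1,\dots,i$: $$s_m\!\left(\tfrac{2l\pi}{2i+1}\right)=\sum_{j=1}^{i}(-1)^j\sin\!\left(\tfrac{2lj\pi}{2i+1}\right)\hat S(2m+1,2i+1,j).$$
   Context: $\mathbb N_0=\{0,1,2,\dots\}$. $B_k$ is the $k$-th Bernoulli number ($B_0=1$, $B_2=1/6,\dots$). For $m\in\mathbb N_0$, $c_m(x)=\frac{(-1)^{m+1}x^{2}}{(2m+2)!}\sum_{j=0}^{m}\binom{2m+2}{2j}x^{2(m-j)}\pi^{2j}B_{2j}(2^{2j-1}-1)$ and $s_m(x)=\frac{(-1)^{m}x}{(2m+1)!}\sum_{j=0}^{m}\binom{2m+1}{2j}x^{2(m-j)}\pi^{2j}B_{2j}(2^{2j-1}-1)$. For integers $n\ge2$, $k\ge2$ and $l$ not divisible by $k$: $S(n,k,l)=\sum_{j\in\mathbb Z}(jk+l)^{-n}$ and $\hat S(n,k,l)=\sum_{j\in\mathbb Z}(-1)^j(jk+l)^{-n}$. *)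

theory Defs
  imports "HOL-Analysis.Analysis"
begin

text \<open>
  Bernoulli numbers through the recurrence $\sum_{k=0}^{n+1} \binom{n+2}{k} B_k = 0$
  with $B_0 = 1$. This is the convention $B_1 = -1/2$; only even indices are used below.
\<close>

fun bernoulli :: "nat \<Rightarrow> real" where
  "bernoulli 0 = 1"
| "bernoulli (Suc n) = - (\<Sum>k\<le>n. real ((n + 2) choose k) * bernoulli k) / real (n + 2)"

text \<open>
  The exponent $2j-1$ is negative for $j = 0$, hence the integer power.
\<close>

definition c_poly :: "nat \<Rightarrow> real \<Rightarrow> real" where
  "c_poly m x = (-1) ^ (m + 1) * x\<^sup>2 / fact (2 * m + 2) *
     (\<Sum>j = 0..m. real ((2 * m + 2) choose (2 * j)) * x ^ (2 * (m - j)) * pi ^ (2 * j) *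
        bernoulli (2 * j) * (2 powi (2 * int j - 1) - 1))"

definition s_poly :: "nat \<Rightarrow> real \<Rightarrow> real" where
  "s_poly m x = (-1) ^ m * x / fact (2 * m + 1) *
     (\<Sum>j = 0..m. real ((2 * m + 1) choose (2 * j)) * x ^ (2 * (m - j)) * pi ^ (2 * j) *
        bernoulli (2 * j) * (2 powi (2 * int j - 1) - 1))"

text \<open>
  These sums over all integers are meant for $n \ge 2$, $k \ge 2$ and $l$ not divisible by $k$.
  Then no denominator vanishes and both families are absolutely summable, so the
  unordered sum \<^const>\<open>infsum\<close> is the value of the bilateral series.
\<close>

definition S_sum :: "nat \<Rightarrow> int \<Rightarrow> int \<Rightarrow> real" where
  "S_sum n k l = (\<Sum>\<^sub>\<infinity>j\<in>(UNIV :: int set). 1 / real_of_int (j * k + l) ^ n)"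

definition S_hat :: "nat \<Rightarrow> int \<Rightarrow> int \<Rightarrow> real" where
  "S_hat n k l = (\<Sum>\<^sub>\<infinity>j\<in>(UNIV :: int set). (-1) powi j / real_of_int (j * k + l) ^ n)"

end

theory Submission
  imports Defs
begin

text \<open>
  On $[0,\pi)$ the polynomials are Fourier series:
  $c_m(x) = \sum_{n\ge1} (-1)^n (\cos(nx) - 1)/n^{2m+2}$ and
  $s_m(x) = \sum_{n\ge1} (-1)^n \sin(nx)/n^{2m+1}$.
  This follows by repeated termwise differentiation, starting from the quadratic case; at each
  stage the constant of integration is determined by the value of the next sine series at $\pi$.
  If $kx$ is an integer multiple of $\pi$, the numerators $(-1)^n\cos(nx)$ and $(-1)^n\sin(nx)$
  are $k$-periodic or $k$-antiperiodic in $n$, so that splitting the bilateral series into residue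
  classes modulo $k$ produces the sums $S$ or $\hat S$; the classes of $j$ and $-j$ contribute
  equally, and the class of $0$ gives the Bernoulli number term.
\<close>

section \<open>Bernoulli numbers\<close>

text \<open>In terms of Bernoulli polynomials this is -2^(k-1) B_k(1/2). It vanishes at every odd k,
  including k = 1 where \<open>bernoulli 1\<close> does not, so the sums over even indices in
  \<open>c_poly\<close> and \<open>s_poly\<close> extend to sums over all indices.\<close>

definition bern_alt :: "nat \<Rightarrow> real" where
  "bern_alt k = bernoulli k * (2 powi (int k - 1) - 1)"

definition bernoulli_fps :: "real fps" where
  "bernoulli_fps = Abs_fps (\<lambda>n. bernoulli n / fact n)"

text \<open>The defining recurrence says precisely that the coefficients of degree at least 2 of
  this product vanish.\<close>

lemma bernoulli_fps_mult_exp: "bernoulli_fps * (fps_exp 1 - 1) = fps_X"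
proof (rule fps_ext)
  fix n
  have *: "fps_nth (bernoulli_fps * (fps_exp 1 - 1)) n
      = (\<Sum>k\<le>n. bernoulli k / fact k * (if k = n then 0 else 1 / fact (n - k)))"
    by (auto simp: fps_mult_nth bernoulli_fps_def atLeast0AtMost intro!: sum.cong)
  show "fps_nth (bernoulli_fps * (fps_exp 1 - 1)) n = fps_nth fps_X n"
  proof (cases n rule: bernoulli.cases)
    case (2 N)
    show ?thesis
    proof (cases N)
      case 0
      then show ?thesis using 2 * by simp
    next
      case (Suc M)
      have "(\<Sum>k\<le>n. bernoulli k / fact k * (if k = n then 0 else 1 / fact (n - k)))
          = (\<Sum>k\<le>Suc M. bernoulli k / fact k * (1 / fact (Suc (Suc M) - k)))"
        using 2 Suc by (simp add: mult.commute cong: if_cong)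
      also have "\<dots> = (\<Sum>k\<le>Suc M. bernoulli k * real ((M+2) choose k) / fact (M+2))"
        by (intro sum.cong) (auto simp: binomial_fact divide_simps)
      also have "\<dots> = (\<Sum>k\<le>Suc M. bernoulli k * real ((M+2) choose k)) / fact (M+2)"
        by (simp only: sum_divide_distrib)
      \<comment> \<open>The last binomial coefficient is M + 2, the denominator in the recurrence,
        so the last summand cancels all the others.\<close>
      also have "(\<Sum>k\<le>Suc M. bernoulli k * real ((M+2) choose k)) = 0"
      proof -
        have "real ((M + 2) choose (Suc M)) = real (M+2)"
          using binomial_Suc_n[of "Suc M"] by (simp del: binomial_Suc_n)
        then show ?thesis
          by (simp add: mult.commute)
      qed
      finally show ?thesis using * 2 Suc by (simp add: mult.commute)
    qed
  qed (use * in simp)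
qed

definition bern_alt_fps :: "real fps" where
  "bern_alt_fps = Abs_fps (\<lambda>n. bern_alt n / fact n)"

text \<open>With B(X) = X/(e^X - 1) the series is B(2X)/2 - B(X) = X/(e^(2X) - 1) - X/(e^X - 1) = -X
  e^X/(e^(2X) - 1), which is -X/(e^X - e^(-X)).\<close>

lemma bern_alt_fps_mult_sinh: "bern_alt_fps * (fps_exp 1 - fps_exp (-1)) = - fps_X"
proof -
  have scale: "bernoulli_fps oo (fps_const 2 * fps_X) = Abs_fps (\<lambda>n. 2 ^ n * bernoulli n / fact n)"
    by (rule fps_ext) (simp add: fps_compose_linear bernoulli_fps_def)
  have D: "bern_alt_fps = fps_const (1/2) * (bernoulli_fps oo (fps_const 2 * fps_X)) - bernoulli_fps"
    unfolding scale
    by (rule fps_ext) (auto simp: bern_alt_fps_def bern_alt_def bernoulli_fps_def power_int_diff field_simps)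
  have "(bernoulli_fps * (fps_exp 1 - 1)) oo (fps_const 2 * fps_X) = fps_X oo (fps_const 2 * fps_X)"
    by (simp add: bernoulli_fps_mult_exp)
  then have G2: "(bernoulli_fps oo (fps_const 2 * fps_X)) * (fps_exp 2 - 1) = fps_const 2 * fps_X"
    by (simp add: fps_compose_mult_distrib fps_compose_sub_distrib)
  have e2: "fps_exp (2::real) = fps_exp 1 * fps_exp 1"
    by (simp add: fps_exp_add_mult[symmetric])
  have em: "fps_exp (-1::real) * fps_exp 1 = 1"
    by (simp add: fps_exp_add_mult[symmetric])
  have hf: "fps_const (1/2) * fps_const (2::real) = 1" by simp
  have G1: "bernoulli_fps * (fps_exp 1 - 1) = fps_X" by (rule bernoulli_fps_mult_exp)
  let ?E = "fps_exp (1::real)" let ?M = "fps_exp (-1::real)"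
  have "bern_alt_fps * (?E * ?E - 1) = - (fps_X * ?E)"
    using G2 G1 hf unfolding D e2 by algebra
  then have "bern_alt_fps * (?E * ?E - 1) * ?M = - (fps_X * ?E) * ?M" by simp
  then show ?thesis using em by algebra
qed

text \<open>Both X and e^X - e^(-X) are odd, so their quotient is an even power series.\<close>

lemma bern_alt_odd:
  assumes "odd n"
  shows "bern_alt n = 0"
proof -
  let ?X = "fps_const (-1) * fps_X :: real fps"
  have "bern_alt_fps oo ?X = bern_alt_fps"
  proof -
    have c: "fps_exp (a::real) oo ?X = fps_exp (-a)" for a
      using fps_exp_compose_linear[of a "-1"] by (simp del: fps_const_neg)
    have "(bern_alt_fps oo ?X) * (fps_exp (-1) - fps_exp 1) = fps_X"
      using arg_cong[OF bern_alt_fps_mult_sinh, of "\<lambda>F. F oo ?X"]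
      by (simp add: fps_compose_mult_distrib fps_compose_sub_distrib fps_compose_uminus c del: fps_const_neg)
    then have "((bern_alt_fps oo ?X) - bern_alt_fps) * (fps_exp 1 - fps_exp (-1)) = 0"
      using bern_alt_fps_mult_sinh by (simp add: algebra_simps)
    \<comment> \<open>Its coefficient of X is 2; power series over a field have no zero divisors, so
      the factor cancels.\<close>
    moreover have "fps_exp 1 - fps_exp (-1) \<noteq> (0::real fps)"
      using arg_cong[of "fps_exp 1 - fps_exp (-1)" "0::real fps" "\<lambda>F. fps_nth F 1"] by auto
    ultimately show ?thesis by simp
  qed
  then have "fps_nth (bern_alt_fps oo ?X) n = fps_nth bern_alt_fps n" by simp
  then show ?thesis using assms
    by (simp add: fps_compose_linear bern_alt_fps_def del: fps_const_neg)
qed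

text \<open>Otherwise simplification would unfold \<open>bernoulli (2 * m + 2)\<close> by the
  recurrence.\<close>

declare bernoulli.simps(2) [simp del]

section \<open>Alternating trigonometric series\<close>

text \<open>
  The term for $n = 0$ vanishes because $1/0 = 0$; likewise the junk term in
  \<^const>\<open>S_sum\<close> and \<^const>\<open>S_hat\<close> for the residue $0$.
\<close>

definition alt_cos :: "nat \<Rightarrow> real \<Rightarrow> real" where
  "alt_cos p x = (\<Sum>n. (-1) ^ n * cos (real n * x) / real n ^ p)"

definition alt_sin :: "nat \<Rightarrow> real \<Rightarrow> real" where
  "alt_sin p x = (\<Sum>n. (-1) ^ n * sin (real n * x) / real n ^ p)"

lemma abs_alternating_term_le:
  assumes "\<bar>u\<bar> \<le> 1"
  shows "\<bar>(-1) ^ n * u / real n ^ p\<bar> \<le> inverse (real n ^ p)"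
  using assms by (simp add: abs_mult divide_inverse mult_left_le_one_le)

lemma alt_cos_sums:
  assumes "p \<ge> 2"
  shows "(\<lambda>n. (-1) ^ n * cos (real n * x) / real n ^ p) sums alt_cos p x"
  unfolding alt_cos_def
  by (intro summable_sums summable_comparison_test'[OF inverse_power_summable[OF assms]])
     (simp_all add: abs_alternating_term_le del: abs_divide)

lemma alt_sin_sums:
  assumes "p \<ge> 2"
  shows "(\<lambda>n. (-1) ^ n * sin (real n * x) / real n ^ p) sums alt_sin p x"
  unfolding alt_sin_def
  by (intro summable_sums summable_comparison_test'[OF inverse_power_summable[OF assms]])
     (simp_all add: abs_alternating_term_le del: abs_divide)

text \<open>For p at least 2 the differentiated series converges uniformly on the whole line by the
  Weierstrass test. The derivative of \<open>alt_cos 2\<close> has exponent 1 and escapes this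
  argument, hence the separate treatment of the quadratic case.\<close>

lemma has_real_derivative_alt_sin:
  assumes "p \<ge> 2"
  shows "(alt_sin (Suc p) has_real_derivative alt_cos p x) (at x)"
  unfolding alt_sin_def alt_cos_def
proof (rule has_field_derivative_series'(2)[where S = UNIV and ?x0.0 = 0])
  show "((\<lambda>x. (-1) ^ n * sin (real n * x) / real n ^ Suc p) has_real_derivative
          (-1) ^ n * cos (real n * x) / real n ^ p) (at x within UNIV)" for n x
    using assms by (cases "n = 0") (auto intro!: derivative_eq_intros)
  show "uniformly_convergent_on UNIV (\<lambda>n x. \<Sum>i<n. (-1) ^ i * cos (real i * x) / real i ^ p)"
    by (intro Weierstrass_m_test'[OF _ inverse_power_summable[OF assms]])
       (simp_all add: abs_alternating_term_le del: abs_divide)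
qed auto

lemma has_real_derivative_alt_cos:
  assumes "p \<ge> 2"
  shows "(alt_cos (Suc p) has_real_derivative - alt_sin p x) (at x)"
proof -
  have "(alt_cos (Suc p) has_real_derivative (\<Sum>n. - ((-1) ^ n * sin (real n * x) / real n ^ p))) (at x)"
    unfolding alt_cos_def
  proof (rule has_field_derivative_series'(2)[where S = UNIV and ?x0.0 = 0])
    show "((\<lambda>x. (-1) ^ n * cos (real n * x) / real n ^ Suc p) has_real_derivative
            - ((-1) ^ n * sin (real n * x) / real n ^ p)) (at x within UNIV)" for n x
      using assms by (cases "n = 0") (auto intro!: derivative_eq_intros)
    show "uniformly_convergent_on UNIV (\<lambda>n x. \<Sum>i<n. - ((-1) ^ i * sin (real i * x) / real i ^ p))"
      by (intro Weierstrass_m_test'[OF _ inverse_power_summable[OF assms]])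
         (simp_all add: abs_alternating_term_le del: abs_divide)
    show "summable (\<lambda>n. (-1) ^ n * cos (real n * 0) / real n ^ Suc p)"
      using assms by (intro sums_summable[OF alt_cos_sums]) auto
  qed auto
  then show ?thesis
    using assms by (simp add: suminf_minus[OF sums_summable[OF alt_sin_sums]] alt_sin_def)
qed

section \<open>The quadratic case\<close>

text \<open>Since 2 cos(t/2) cos(nt) = cos((n - 1/2)t) + cos((n + 1/2)t), the alternating sum
  telescopes.\<close>

lemma alternating_dirichlet_kernel:
  fixes t :: real
  shows "2 * cos (t / 2) * (\<Sum>n\<in>{1..N}. (-1) ^ n * cos (real n * t)) =
         (-1) ^ N * cos ((real N + 1 / 2) * t) - cos (t / 2)"
proof (induction N)
  case (Suc N)
  have "2 * cos (t / 2) * cos (real (Suc N) * t) =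
        cos ((real N + 1 / 2) * t) + cos ((real (Suc N) + 1 / 2) * t)"
  proof -
    have "t / 2 - real (Suc N) * t = - ((real N + 1 / 2) * t)"
      "t / 2 + real (Suc N) * t = (real (Suc N) + 1 / 2) * t"
      by (simp_all add: field_simps)
    then show ?thesis
      by (simp only: mult.assoc cos_times_cos cos_minus) simp
  qed
  then show ?case using Suc by (simp add: algebra_simps)
qed simp

lemma abs_increment_le:
  fixes f :: "real \<Rightarrow> real"
  assumes "a \<le> b" and "\<And>t. a \<le> t \<Longrightarrow> t \<le> b \<Longrightarrow> (f has_real_derivative f' t) (at t)"
    and "\<And>t. a \<le> t \<Longrightarrow> t \<le> b \<Longrightarrow> \<bar>f' t\<bar> \<le> B"
  shows "\<bar>f b - f a\<bar> \<le> (b - a) * B"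
proof (cases "a = b")
  case False
  then obtain z where "a < z" "z < b" "f b - f a = (b - a) * f' z"
    using MVT2[of a b f f'] assms by auto
  then show ?thesis using assms(1) assms(3)[of z] by (simp add: abs_mult mult_left_mono)
qed simp

text \<open>A quantitative form of the sawtooth series for t/2, obtained by integrating the
  Dirichlet kernel. The constant depends on x only, because cos(t/2) is at least cos(x/2) > 0 on
  [0,x]; this uniformity in t replaces the Weierstrass test.\<close>

lemma alternating_sine_sum_bound:
  fixes x t :: real
  assumes "0 \<le> t" "t \<le> x" "x < pi"
  shows "\<bar>(\<Sum>n\<le>N. - ((-1) ^ n * sin (real n * t) / real n)) - t / 2\<bar>
     \<le> (x / (2 * cos (x / 2) ^ 2) + 1 / cos (x / 2)) / (2 * real N + 1)"
proof -
  define c where "c = cos (x / 2)"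
  have c: "c > 0" unfolding c_def using assms by (intro cos_gt_zero_pi) auto
  have cge: "cos (s / 2) \<ge> c" if "0 \<le> s" "s \<le> x" for s
    unfolding c_def using that assms by (intro cos_monotone_0_pi_le) auto
  define a where "a = real N + 1 / 2"
  have a: "a > 0" "2 * real N + 1 = 2 * a" by (auto simp: a_def)
  define G where "G t = (\<Sum>n\<le>N. - ((-1) ^ n * sin (real n * t) / real n))" for t
  \<comment> \<open>The boundary term of an integration by parts: \<open>cos (a * t)\<close> is
    integrated while \<open>1 / cos (t / 2)\<close> is kept.\<close>
  define g where "g t = (-1) ^ N * sin (a * t) / (2 * a * cos (t / 2))" for t
  \<comment> \<open>The derivative of \<open>g\<close> cancels the oscillating part of \<open>G'\<close>, leaving \<open>Q' = O(1/N)\<close>.\<close>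
  define Q where "Q t = G t - t / 2 + g t" for t
  have dG: "(G has_real_derivative (1 / 2 - (-1) ^ N * cos (a * s) / (2 * cos (s / 2)))) (at s)"
    if "0 \<le> s" "s \<le> x" for s
  proof -
    \<comment> \<open>The summand for n = 0 is identically 0, whereas the general formula would give
      -1.\<close>
    have "(G has_real_derivative (\<Sum>n\<le>N. if n = 0 then 0 else - ((-1) ^ n * cos (real n * s)))) (at s)"
      unfolding G_def
    proof (rule DERIV_sum)
      fix n show "((\<lambda>t. - ((-1) ^ n * sin (real n * t) / real n)) has_real_derivative
          (if n = 0 then 0 else - ((-1) ^ n * cos (real n * s)))) (at s)"
        by (cases "n = 0") (auto intro!: derivative_eq_intros)
    qed
    also have "(\<Sum>n\<le>N. if n = 0 then 0 else - ((-1) ^ n * cos (real n * s)))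
        = (\<Sum>n\<in>{1..N}. - ((-1) ^ n * cos (real n * s)))"
      by (intro sum.mono_neutral_cong_right) auto
    also have "\<dots> = - (\<Sum>n\<in>{1..N}. (-1) ^ n * cos (real n * s))"
      by (rule sum_negf)
    also have "\<dots> = 1 / 2 - (-1) ^ N * cos (a * s) / (2 * cos (s / 2))"
      using alternating_dirichlet_kernel[of s N] cge[OF that] c
      unfolding a_def[symmetric] by (simp add: field_simps)
    finally show ?thesis .
  qed
  have dg: "(g has_real_derivative ((-1) ^ N * cos (a * s) / (2 * cos (s / 2)) +
      (-1) ^ N * sin (a * s) * sin (s / 2) / (4 * a * cos (s / 2) ^ 2))) (at s)"
    if "0 \<le> s" "s \<le> x" for s
    unfolding g_def using a cge[OF that] c
    by (auto intro!: derivative_eq_intros simp: field_simps power2_eq_square)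
  have "\<bar>Q t - Q 0\<bar> \<le> (t - 0) * (1 / (4 * a * c ^ 2))"
  proof (rule abs_increment_le)
    fix s assume s: "0 \<le> s" "s \<le> t"
    then have s': "0 \<le> s" "s \<le> x" using assms by auto
    show "(Q has_real_derivative (-1) ^ N * sin (a * s) * sin (s / 2) / (4 * a * cos (s / 2) ^ 2)) (at s)"
      unfolding Q_def by (rule derivative_eq_intros dG dg s' refl | simp)+
    have "\<bar>(-1) ^ N * sin (a * s) * sin (s / 2)\<bar> \<le> 1"
      by (simp add: abs_mult mult_le_one)
    then show "\<bar>(-1) ^ N * sin (a * s) * sin (s / 2) / (4 * a * cos (s / 2) ^ 2)\<bar> \<le> 1 / (4 * a * c ^ 2)"
      using a c cge[OF s'] unfolding abs_divide
      by (intro frac_le) (auto intro!: mult_left_mono power_mono simp: abs_mult)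
  qed (use assms in auto)
  also have "\<dots> \<le> x * (1 / (4 * a * c ^ 2))"
    using assms a c by (intro mult_right_mono) auto
  \<comment> \<open>All sines vanish at 0, hence \<open>Q 0 = 0\<close>.\<close>
  finally have 1: "\<bar>Q t\<bar> \<le> x / (4 * a * c ^ 2)"
    by (simp add: Q_def G_def g_def)
  have 2: "\<bar>g t\<bar> \<le> 1 / (2 * a * c)"
    unfolding g_def abs_divide using a c cge[of t] assms
    by (intro frac_le) (auto simp: abs_mult)
  have "\<bar>G t - t / 2\<bar> \<le> \<bar>Q t\<bar> + \<bar>g t\<bar>" by (simp add: Q_def)
  also have "\<dots> \<le> x / (4 * a * c ^ 2) + 1 / (2 * a * c)" using 1 2 by simp
  also have "\<dots> = (x / (2 * c ^ 2) + 1 / c) / (2 * a)"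
    using a c by (simp add: field_simps power2_eq_square)
  finally show ?thesis unfolding G_def c_def a .
qed

text \<open>The derivative of the N-th partial sum differs from t/2 by O(1/N) uniformly on [0,x], so
  by the mean value theorem the increment over [0,x] tends to that of t^2/4. The value at 0 is still
  unknown here.\<close>

lemma alt_cos_2:
  assumes "0 \<le> x" "x < pi"
  shows "alt_cos 2 x - alt_cos 2 0 = x ^ 2 / 4"
proof -
  define M where "M = x / (2 * cos (x / 2) ^ 2) + 1 / cos (x / 2)"
  define F where "F N t = (\<Sum>n\<le>N. (-1) ^ n * cos (real n * t) / real n ^ 2)" for N t
  have F_lim: "(\<lambda>N. F N t) \<longlonglongrightarrow> alt_cos 2 t" for t
    using alt_cos_sums[of 2 t] unfolding sums_def_le F_def by simp
  have bound: "\<bar>(F N x - x ^ 2 / 4) - (F N 0 - 0 ^ 2 / 4)\<bar> \<le> (x - 0) * (M / (2 * real N + 1))" for N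
  proof (rule abs_increment_le)
    fix t assume t: "0 \<le> t" "t \<le> x"
    have "(F N has_real_derivative (\<Sum>n\<le>N. - ((-1) ^ n * sin (real n * t) / real n))) (at t)"
      unfolding F_def
    proof (rule DERIV_sum)
      fix n show "((\<lambda>t. (-1) ^ n * cos (real n * t) / real n ^ 2) has_real_derivative
          - ((-1) ^ n * sin (real n * t) / real n)) (at t)"
        by (cases "n = 0") (auto intro!: derivative_eq_intros simp: power2_eq_square)
    qed
    then show "((\<lambda>t. F N t - t ^ 2 / 4) has_real_derivative
        (\<Sum>n\<le>N. - ((-1) ^ n * sin (real n * t) / real n)) - t / 2) (at t)"
      by (auto intro!: derivative_eq_intros)
    show "\<bar>(\<Sum>n\<le>N. - ((-1) ^ n * sin (real n * t) / real n)) - t / 2\<bar> \<le> M / (2 * real N + 1)"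
      unfolding M_def using t assms by (intro alternating_sine_sum_bound) auto
  qed (use assms in auto)
  have lim: "(\<lambda>N. (x - 0) * (M / (2 * real N + 1))) \<longlonglongrightarrow> 0"
  proof -
    have "filterlim (\<lambda>N. 2 * real N + 1) at_top sequentially"
      by (intro filterlim_at_top_mono[OF filterlim_real_sequentially]) auto
    then have "(\<lambda>N. M / (2 * real N + 1)) \<longlonglongrightarrow> 0"
      by (rule real_tendsto_divide_at_top[OF tendsto_const])
    then show ?thesis by (rule tendsto_mult_right_zero)
  qed
  have "(\<lambda>N. (F N x - x ^ 2 / 4) - (F N 0 - 0 ^ 2 / 4)) \<longlonglongrightarrow> 0"
    by (rule Lim_null_comparison[OF _ lim], unfold real_norm_def)
       (intro always_eventually allI bound)
  moreover have "(\<lambda>N. (F N x - x ^ 2 / 4) - (F N 0 - 0 ^ 2 / 4)) \<longlonglongrightarrow>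
      (alt_cos 2 x - x ^ 2 / 4) - (alt_cos 2 0 - 0 ^ 2 / 4)"
    by (intro tendsto_diff tendsto_const F_lim)
  ultimately have "(alt_cos 2 x - x ^ 2 / 4) - (alt_cos 2 0 - 0 ^ 2 / 4) = 0"
    by (rule LIMSEQ_unique[symmetric])
  then show ?thesis by simp
qed

section \<open>Closed forms of the series\<close>

text \<open>A rescaled Bernoulli polynomial, -(2 pi)^p B_p((x + pi)/(2 pi)) / (2 p!). The factorials
  are distributed so that differentiation lowers the index without a factor.\<close>

definition alt_poly :: "nat \<Rightarrow> real \<Rightarrow> real" where
  "alt_poly p x = (\<Sum>k\<le>p. bern_alt k * pi ^ k / fact k * (x ^ (p - k) / fact (p - k)))"

lemma has_real_derivative_alt_poly:
  "(alt_poly (Suc p) has_real_derivative alt_poly p x) (at x)"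
proof -
  have "((\<lambda>x. \<Sum>k\<le>p. bern_alt k * pi ^ k / fact k * (x ^ (Suc p - k) / fact (Suc p - k)))
      has_real_derivative alt_poly p x) (at x)"
    unfolding alt_poly_def
  proof (intro DERIV_sum DERIV_cmult)
    fix k assume "k \<in> {..p}"
    then have "Suc p - k = Suc (p - k)" by auto
    then show "((\<lambda>x. x ^ (Suc p - k) / fact (Suc p - k)) has_real_derivative
        x ^ (p - k) / fact (p - k)) (at x)"
      using DERIV_cdivide[OF DERIV_pow[of "Suc (p - k)" x UNIV], of "fact (Suc (p - k))"]
      by (simp del: of_nat_Suc)
  qed
  then have "((\<lambda>x. (\<Sum>k\<le>p. bern_alt k * pi ^ k / fact k * (x ^ (Suc p - k) / fact (Suc p - k)))
      + bern_alt (Suc p) * pi ^ Suc p / fact (Suc p)) has_real_derivative alt_poly p x + 0) (at x)"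
    by (intro DERIV_add DERIV_const)
  moreover have "alt_poly (Suc p) = (\<lambda>x. (\<Sum>k\<le>p. bern_alt k * pi ^ k / fact k * (x ^ (Suc p - k) / fact (Suc p - k)))
      + bern_alt (Suc p) * pi ^ Suc p / fact (Suc p))"
    by (simp add: alt_poly_def fun_eq_iff)
  ultimately show ?thesis by simp
qed

lemma alt_poly_0: "alt_poly p 0 = bern_alt p * pi ^ p / fact p"
proof -
  have "alt_poly p 0 = (\<Sum>k\<in>{p}. bern_alt k * pi ^ k / fact k * (0 ^ (p - k) / fact (p - k)))"
    unfolding alt_poly_def by (rule sum.mono_neutral_right) auto
  then show ?thesis by simp
qed

text \<open>Up to pi^n this is a coefficient of \<open>bern_alt_fps\<close> times e^X. Only even k
  contribute, so n - k is odd, where e^X - e^(-X) has twice the coefficient of e^X; the value is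
  thus half a coefficient of -X. For n = 1 it is -pi/2.\<close>

lemma alt_poly_odd_pi:
  assumes "odd n" "n \<noteq> 1"
  shows "alt_poly n pi = 0"
proof -
  have "(\<Sum>k\<le>n. 2 * (bern_alt k / fact k * (1 / fact (n - k))))
      = fps_nth (bern_alt_fps * (fps_exp 1 - fps_exp (-1))) n"
    unfolding fps_mult_nth atLeast0AtMost
  proof (rule sum.cong)
    fix k assume "k \<in> {..n}"
    then show "2 * (bern_alt k / fact k * (1 / fact (n - k)))
        = fps_nth bern_alt_fps k * fps_nth (fps_exp 1 - fps_exp (-1)) (n - k)"
      using assms(1) by (cases "odd k") (auto simp: bern_alt_odd bern_alt_fps_def)
  qed simp
  also have "\<dots> = 0" using assms by (simp add: bern_alt_fps_mult_sinh)
  finally have 0: "(\<Sum>k\<le>n. bern_alt k / fact k * (1 / fact (n - k))) = 0"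
    unfolding sum_distrib_left[symmetric] by simp
  have "alt_poly n pi = (\<Sum>k\<le>n. pi ^ n * (bern_alt k / fact k * (1 / fact (n - k))))"
    unfolding alt_poly_def
  proof (rule sum.cong)
    fix k assume "k \<in> {..n}"
    then have "pi ^ n = pi ^ k * pi ^ (n - k)" by (simp flip: power_add)
    then show "bern_alt k * pi ^ k / fact k * (pi ^ (n - k) / fact (n - k))
        = pi ^ n * (bern_alt k / fact k * (1 / fact (n - k)))"
      by simp
  qed simp
  also have "\<dots> = pi ^ n * (\<Sum>k\<le>n. bern_alt k / fact k * (1 / fact (n - k)))"
    by (rule sum_distrib_left[symmetric])
  finally show ?thesis using 0 by simp
qed

text \<open>Integration from 0 turns K into the term K x. At pi both the sine series and the
  polynomial vanish, which leaves K pi = 0. The cosine identity is assumed only below pi; continuity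
  carries the integrated one to the endpoint.\<close>

lemma alt_sin_odd_eq_alt_poly:
  assumes m: "m \<ge> 1"
    and cos: "\<And>x. 0 \<le> x \<Longrightarrow> x < pi \<Longrightarrow> alt_cos (2 * m) x = (-1) ^ m * alt_poly (2 * m) x + K"
  shows "K = 0 \<and> (\<forall>x\<in>{0..pi}. alt_sin (2 * m + 1) x = (-1) ^ m * alt_poly (2 * m + 1) x)"
proof -
  let ?h = "\<lambda>t. alt_sin (2 * m + 1) t - (-1) ^ m * alt_poly (2 * m + 1) t - K * t"
  have h': "(?h has_real_derivative alt_cos (2 * m) t - (-1) ^ m * alt_poly (2 * m) t - K) (at t)" for t
    using has_real_derivative_alt_sin[of "2 * m" t] has_real_derivative_alt_poly[of "2 * m" t] m
    by (auto intro!: derivative_eq_intros)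
  have "?h 0 = 0"
    by (simp add: alt_sin_def alt_poly_0 bern_alt_odd)
  have h: "?h x = 0" if "0 \<le> x" "x \<le> pi" for x
  proof (cases "x = 0")
    case False
    have "?h x = ?h 0"
    proof (rule DERIV_isconst_end[where f = ?h])
      show "continuous_on {0..x} ?h"
        using h' by (intro DERIV_continuous_on) (blast intro: has_field_derivative_at_within)
      show "(?h has_real_derivative 0) (at t)" if "0 < t" "t < x" for t
        using h'[of t] cos[of t] that \<open>x \<le> pi\<close> by simp
    qed (use that False in auto)
    then show ?thesis using \<open>?h 0 = 0\<close> by simp
  qed (use \<open>?h 0 = 0\<close> in simp)
  have "alt_sin (2 * m + 1) pi = 0" by (simp add: alt_sin_def)
  then have "K = 0" using h[of pi] alt_poly_odd_pi[of "2 * m + 1"] m by simp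
  then show ?thesis using h by auto
qed

lemma bern_alt_0: "bern_alt 0 = - 1 / 2" and bern_alt_1: "bern_alt 1 = 0"
  by (simp_all add: bern_alt_def power_int_minus)

text \<open>The constant stays existential during the induction: it is seen to be 0 only after one
  further integration. In the step the constant for m is eliminated in this way, and integrating the
  resulting sine identity introduces a new one for m + 1.\<close>

lemma alt_cos_eq_alt_poly_const:
  assumes "m \<ge> 1"
  shows "\<exists>K. \<forall>x. 0 \<le> x \<longrightarrow> x < pi \<longrightarrow> alt_cos (2 * m) x = (-1) ^ m * alt_poly (2 * m) x + K"
  using assms
proof (induction m rule: dec_induct)
  case base
  \<comment> \<open>The linear term is absent because \<open>bern_alt 1 = 0\<close>, and the
    quadratic coefficient is \<open>bern_alt 0 / 2\<close>.\<close>
  have poly: "alt_poly 2 x = alt_poly 2 0 - x ^ 2 / 4" for x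
    using bern_alt_1 by (simp add: alt_poly_def bern_alt_0 eval_nat_numeral)
  have "alt_cos (2 * 1) x = (-1) ^ 1 * alt_poly (2 * 1) x + (alt_cos 2 0 + alt_poly 2 0)"
    if "0 \<le> x" "x < pi" for x
    unfolding mult_1_right power_one_right using alt_cos_2[OF that] poly[of x] by linarith
  then show ?case by blast
next
  case (step m)
  then obtain K where K: "\<And>x. 0 \<le> x \<Longrightarrow> x < pi \<Longrightarrow> alt_cos (2 * m) x = (-1) ^ m * alt_poly (2 * m) x + K"
    by blast
  have S: "\<forall>x\<in>{0..pi}. alt_sin (2 * m + 1) x = (-1) ^ m * alt_poly (2 * m + 1) x"
    using alt_sin_odd_eq_alt_poly[of m K] step(1) K by blast
  let ?h = "\<lambda>t. alt_cos (2 * Suc m) t - (-1) ^ Suc m * alt_poly (2 * Suc m) t"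
  have h': "(?h has_real_derivative 0) (at t)" if "0 \<le> t" "t \<le> pi" for t
  proof -
    have "alt_sin (2 * m + 1) t = (-1) ^ m * alt_poly (2 * m + 1) t"
      using S that by simp
    then have "- alt_sin (2 * m + 1) t - (-1) ^ Suc m * alt_poly (2 * m + 1) t = 0" by simp
    moreover have "(?h has_real_derivative
        - alt_sin (2 * m + 1) t - (-1) ^ Suc m * alt_poly (2 * m + 1) t) (at t)"
    proof -
      have "2 * Suc m = Suc (2 * m + 1)" "2 * m + 1 \<ge> 2" using step(1) by simp_all
      show ?thesis
        unfolding \<open>2 * Suc m = Suc (2 * m + 1)\<close>
        by (intro DERIV_diff DERIV_cmult has_real_derivative_alt_poly
              has_real_derivative_alt_cos \<open>2 * m + 1 \<ge> 2\<close>)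
    qed
    ultimately show ?thesis by (simp only:)
  qed
  have "?h x = ?h 0" if "0 \<le> x" "x < pi" for x
  proof (cases "x = 0")
    case False
    show ?thesis
    proof (rule DERIV_isconst_end[where f = ?h])
      show "continuous_on {0..x} ?h"
      proof (rule DERIV_continuous_on)
        show "(?h has_real_derivative 0) (at t within {0..x})" if "t \<in> {0..x}" for t
          using h'[of t] that \<open>x < pi\<close> by (simp add: has_field_derivative_at_within)
      qed
      show "(?h has_real_derivative 0) (at t)" if "0 < t" "t < x" for t
        using h'[of t] that \<open>x < pi\<close> by simp
    qed (use that False in simp)
  qed simp
  then have "alt_cos (2 * Suc m) x = (-1) ^ Suc m * alt_poly (2 * Suc m) x + ?h 0"
    if "0 \<le> x" "x < pi" for x
    using that by (metis add.commute diff_add_cancel)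
  then show ?case by blast
qed

lemma alt_cos_even:
  assumes "m \<ge> 1" "0 \<le> x" "x < pi"
  shows "alt_cos (2 * m) x = (-1) ^ m * alt_poly (2 * m) x"
  using alt_cos_eq_alt_poly_const[OF assms(1)] alt_sin_odd_eq_alt_poly[OF assms(1)] assms(2,3)
  by (metis add.right_neutral)

lemma alt_sin_odd:
  assumes "m \<ge> 1" "0 \<le> x" "x \<le> pi"
  shows "alt_sin (2 * m + 1) x = (-1) ^ m * alt_poly (2 * m + 1) x"
  using alt_sin_odd_eq_alt_poly[OF assms(1), of 0] alt_cos_even[OF assms(1)] assms(2,3)
  by simp

lemma alt_poly_eq_sum_even:
  "alt_poly p x = (\<Sum>j\<le>p div 2. bern_alt (2 * j) * pi ^ (2 * j) / fact (2 * j) * (x ^ (p - 2 * j) / fact (p - 2 * j)))"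
proof -
  have "alt_poly p x = (\<Sum>k\<in>(*) 2 ` {..p div 2}. bern_alt k * pi ^ k / fact k * (x ^ (p - k) / fact (p - k)))"
    unfolding alt_poly_def
  proof (rule sum.mono_neutral_right)
    show "\<forall>k\<in>{..p} - (*) 2 ` {..p div 2}. bern_alt k * pi ^ k / fact k * (x ^ (p - k) / fact (p - k)) = 0"
    proof
      fix k assume k: "k \<in> {..p} - (*) 2 ` {..p div 2}"
      have "odd k"
      proof
        assume "even k"
        then obtain j where "k = 2 * j" by blast
        then show False using k by auto
      qed
      then show "bern_alt k * pi ^ k / fact k * (x ^ (p - k) / fact (p - k)) = 0"
        by (simp add: bern_alt_odd)
    qed
  qed auto
  then show ?thesis by (simp add: sum.reindex inj_on_def)
qed

section \<open>The given polynomials as Fourier series\<close>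

text \<open>The sum in \<open>c_poly\<close> stops at j = m. The missing term j = m + 1 of
  \<open>alt_poly (2 * m + 2) x\<close> is its constant term, hence the subtraction of the value at
  0.\<close>

lemma c_poly_eq_alt_cos:
  assumes "0 \<le> x" "x < pi"
  shows "c_poly m x = alt_cos (2 * m + 2) x - alt_cos (2 * m + 2) 0"
proof -
  have "c_poly m x = (-1) ^ (m + 1) * (\<Sum>j\<le>m. bern_alt (2 * j) * pi ^ (2 * j) / fact (2 * j) *
      (x ^ (2 * m + 2 - 2 * j) / fact (2 * m + 2 - 2 * j)))"
    unfolding c_poly_def atLeast0AtMost sum_distrib_left
  proof (rule sum.cong[OF refl], goal_cases)
    case (1 j)
    then have "2 * j \<le> 2 * m + 2" "2 * m + 2 - 2 * j = 2 + 2 * (m - j)" by auto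
    moreover from this have "x ^ (2 * m + 2 - 2 * j) = x ^ 2 * x ^ (2 * (m - j))"
      by (simp only: power_add)
    ultimately show ?case
      by (simp add: binomial_fact bern_alt_def del: fact_Suc power_Suc)
  qed
  also have "\<dots> = (-1) ^ (m + 1) * (alt_poly (2 * (m + 1)) x - alt_poly (2 * (m + 1)) 0)"
    unfolding alt_poly_0 by (simp add: alt_poly_eq_sum_even)
  finally show ?thesis
    using alt_cos_even[of "m + 1" x] alt_cos_even[of "m + 1" 0] assms
    by (simp add: right_diff_distrib)
qed

text \<open>The even indices up to 2m + 1 are exhausted by j at most m, so no constant has to be
  subtracted.\<close>

lemma s_poly_eq_alt_sin:
  assumes "m \<ge> 1" "0 \<le> x" "x < pi"
  shows "s_poly m x = alt_sin (2 * m + 1) x"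
proof -
  have "s_poly m x = (-1) ^ m * (\<Sum>j\<le>m. bern_alt (2 * j) * pi ^ (2 * j) / fact (2 * j) *
      (x ^ (2 * m + 1 - 2 * j) / fact (2 * m + 1 - 2 * j)))"
    unfolding s_poly_def atLeast0AtMost sum_distrib_left
  proof (rule sum.cong[OF refl], goal_cases)
    case (1 j)
    then have "2 * j \<le> 2 * m + 1" "2 * m + 1 - 2 * j = Suc (2 * (m - j))" by auto
    moreover from this have "x ^ (2 * m + 1 - 2 * j) = x * x ^ (2 * (m - j))"
      by (simp only: power_Suc)
    ultimately show ?case
      by (simp add: binomial_fact bern_alt_def del: fact_Suc power_Suc)
  qed
  also have "\<dots> = (-1) ^ m * alt_poly (2 * m + 1) x"
    by (simp add: alt_poly_eq_sum_even)
  finally show ?thesis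
    using alt_sin_odd[OF assms(1,2)] assms(3) by simp
qed

section \<open>Alternating and ordinary zeta values at even integers\<close>

lemma alt_cos_at_0:
  "alt_cos (2 * m + 2) 0 =
     - (pi ^ (2 * m + 2) * (-1) ^ m * bernoulli (2 * m + 2) * (2 ^ (2 * m + 1) - 1) / fact (2 * m + 2))"
proof -
  have "bern_alt (2 * m + 2) = bernoulli (2 * m + 2) * (2 ^ (2 * m + 1) - 1)"
  proof -
    have "int (2 * m + 2) - 1 = int (2 * m + 1)" by simp
    then show ?thesis unfolding bern_alt_def by (simp only: power_int_of_nat)
  qed
  then show ?thesis
    using alt_cos_even[of "m + 1" 0] by (simp add: alt_poly_0)
qed

text \<open>Adding the zeta series z with exponent p = 2m + 2 to its alternating version kills the
  odd n and doubles the even ones, so z + \<open>alt_cos p 0\<close> = 2 z / 2^p. This is solved for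
  z.\<close>

lemma inverse_even_powers_sums:
  "(\<lambda>n. 1 / real n ^ (2 * m + 2)) sums
     ((-1) ^ m * bernoulli (2 * m + 2) * pi ^ (2 * m + 2) * 2 ^ (2 * m + 1) / fact (2 * m + 2))"
proof -
  let ?p = "2 * m + 2"
  define z where "z = (\<Sum>n. 1 / real n ^ ?p)"
  have z: "(\<lambda>n. 1 / real n ^ ?p) sums z"
    unfolding z_def using inverse_power_summable[of ?p, where ?'a = real]
    by (intro summable_sums) (simp add: inverse_eq_divide)
  have "(\<lambda>n. 2 / 2 ^ ?p * (1 / real n ^ ?p)) sums (2 / 2 ^ ?p * z)"
    by (rule sums_mult[OF z])
  then have "(\<lambda>n. ((-1) ^ (2 * n) + 1) / real (2 * n) ^ ?p) sums (2 / 2 ^ ?p * z)"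
    by (simp add: power_mult_distrib del: power_Suc)
  \<comment> \<open>Inserting the odd indices changes nothing, since their numerators are 0.\<close>
  moreover have "(\<lambda>n. ((-1) ^ (2 * n) + 1) / real (2 * n) ^ ?p) sums (2 / 2 ^ ?p * z) \<longleftrightarrow>
      (\<lambda>n. ((-1) ^ n + 1) / real n ^ ?p) sums (2 / 2 ^ ?p * z)"
    by (rule sums_mono_reindex) (auto simp: strict_mono_def uminus_power_if elim!: evenE)
  ultimately have 1: "(\<lambda>n. ((-1) ^ n + 1) / real n ^ ?p) sums (2 / 2 ^ ?p * z)" by blast
  have "(\<lambda>n. (-1) ^ n * cos (real n * 0) / real n ^ ?p + 1 / real n ^ ?p) sums (alt_cos ?p 0 + z)"
    by (intro sums_add z alt_cos_sums) simp
  then have "(\<lambda>n. ((-1) ^ n + 1) / real n ^ ?p) sums (alt_cos ?p 0 + z)"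
    by (simp only: mult_zero_right cos_zero mult_1_right add_divide_distrib)
  with 1 have "2 / 2 ^ ?p * z = alt_cos ?p 0 + z" by (rule sums_unique2)
  moreover have "(2::real) ^ ?p = 2 * 2 ^ (2 * m + 1)" by simp
  ultimately have eq: "(1 - 1 / 2 ^ (2 * m + 1)) * z = - alt_cos ?p 0" by (simp add: algebra_simps)
  \<comment> \<open>Clearing the denominator produces the factor t - 1, which also occurs in
    \<open>alt_cos_at_0\<close> and is nonzero because t > 1.\<close>
  define t :: real where "t = 2 ^ (2 * m + 1)"
  have t: "t > 1" unfolding t_def by (rule one_less_power) auto
  have "(t - 1) * z = t * - alt_cos ?p 0"
    using eq t unfolding t_def[symmetric] by (simp add: field_simps)
  also have "\<dots> = (t - 1) * ((-1) ^ m * bernoulli ?p * pi ^ ?p * t / fact ?p)"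
    unfolding alt_cos_at_0 t_def[symmetric] by (simp del: power_Suc fact_Suc)
  finally have "z = (-1) ^ m * bernoulli ?p * pi ^ ?p * t / fact ?p"
    using t by (metis diff_gt_0_iff_gt less_irrefl mult_left_cancel)
  with z show ?thesis unfolding t_def by simp
qed

section \<open>Splitting into residue classes\<close>

text \<open>Links one-sided ordered series with bilateral unordered sums. Absolute convergence makes
  the series over the naturals an unordered sum, and evenness gives the negative half the same
  value.\<close>

lemma infsum_int_even:
  fixes f :: "int \<Rightarrow> real"
  assumes even: "\<And>n. f (- n) = f n" and zero: "f 0 = 0"
    and abs: "summable (\<lambda>n. \<bar>f (int n)\<bar>)"
  shows "f summable_on UNIV" and "infsum f UNIV = 2 * (\<Sum>n. f (int n))"
proof -
  have "((\<lambda>n. f (int n)) has_sum (\<Sum>n. f (int n))) UNIV"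
    using abs by (simp add: norm_summable_imp_has_sum summable_sums summable_rabs_cancel)
  moreover have "((\<lambda>n. f (int n)) has_sum s) UNIV \<longleftrightarrow> ((\<lambda>n. f (int n)) has_sum s) {1..}" for s
  proof (rule has_sum_cong_neutral)
    fix n :: nat assume "n \<in> UNIV - {1..}"
    then have "n = 0" by (simp add: not_less_eq_eq)
    then show "f (int n) = 0" using zero by simp
  qed simp_all
  ultimately have nat: "((\<lambda>n. f (int n)) has_sum (\<Sum>n. f (int n))) {1..}" by simp
  have pos: "(f has_sum (\<Sum>n. f (int n))) {1..}"
    using nat
    by (rule has_sum_reindex_bij_witness[where i = int and j = nat, THEN iffD2, rotated -1]) auto
  have neg: "(f has_sum (\<Sum>n. f (int n))) {..-1}"
    using pos
    by (rule has_sum_reindex_bij_witness[where i = uminus and j = uminus, THEN iffD2, rotated -1])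
       (auto simp: even)
  have "(f has_sum ((\<Sum>n. f (int n)) + (\<Sum>n. f (int n)))) ({1..} \<union> {..-1})"
    using pos neg by (rule has_sum_Un_disjoint) auto
  moreover have "(f has_sum s) ({1..} \<union> {..-1}) \<longleftrightarrow> (f has_sum s) UNIV" for s
  proof (rule has_sum_cong_neutral)
    fix n :: int assume "n \<in> UNIV - ({1..} \<union> {..-1})"
    then have "n = 0" by (simp add: not_le)
    then show "f n = 0" using zero by simp
  qed simp_all
  ultimately have "(f has_sum 2 * (\<Sum>n. f (int n))) UNIV" by simp
  then show "f summable_on UNIV" "infsum f UNIV = 2 * (\<Sum>n. f (int n))"
    by (auto simp: summable_on_def infsumI)
qed

text \<open>Division with remainder is a bijection of the integers with pairs of a residue and a
  quotient; summability allows the iterated summation.\<close>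

lemma infsum_int_residues:
  fixes f :: "int \<Rightarrow> real"
  assumes "f summable_on UNIV" and "k > 0"
  shows "infsum f UNIV = (\<Sum>r<k. \<Sum>\<^sub>\<infinity>q. f (q * int k + int r))"
proof -
  let ?h = "\<lambda>(r, q). f (q * int k + int r)"
  have bij: "bij_betw (\<lambda>(r, q). q * int k + int r) ({..<k} \<times> UNIV) UNIV"
    using assms(2)
    by (intro bij_betw_byWitness[where f' = "\<lambda>n. (nat (n mod int k), n div int k)"])
       (auto simp: nat_less_iff)
  have "infsum f UNIV = infsum ?h ({..<k} \<times> UNIV)"
    using infsum_reindex_bij_betw[OF bij, of f] by (simp add: case_prod_unfold)
  moreover have "?h summable_on ({..<k} \<times> UNIV)"
    using summable_on_reindex_bij_betw[OF bij, of f] assms(1) by (simp add: case_prod_unfold)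
  ultimately show ?thesis
    by (simp add: infsum_Sigma'_banach[symmetric])
qed

text \<open>The involution q -> -q - 1 matches the class of k - r with the negatives of the class of
  r.\<close>

lemma infsum_residue_reflect:
  fixes f :: "int \<Rightarrow> real"
  assumes even: "\<And>n. f (- n) = f n"
  shows "(\<Sum>\<^sub>\<infinity>q. f (q * k + (k - r))) = (\<Sum>\<^sub>\<infinity>q. f (q * k + r))"
proof (rule infsum_reindex_bij_witness[where i = "\<lambda>q. - q - 1" and j = "\<lambda>q. - q - 1"])
  fix q
  have "(- q - 1) * k + r = - (q * k + (k - r))" by (simp add: algebra_simps)
  then show "f ((- q - 1) * k + r) = f (q * k + (k - r))" by (simp only: even)
qed auto

text \<open>Residues r and k - r are paired. For even k the residue i = k/2 is its own partner and
  counts once.\<close>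

lemma sum_reflect_upper:
  fixes T :: "nat \<Rightarrow> real"
  assumes "\<And>r. r < k \<Longrightarrow> T (k - r) = T r"
  shows "k = 2 * i + 1 \<Longrightarrow> sum T {..<k} = T 0 + 2 * (\<Sum>j = 1..i. T j)"
    and "k = 2 * i \<Longrightarrow> i \<ge> 1 \<Longrightarrow> sum T {..<k} = T 0 + 2 * (\<Sum>j = 1..i - 1. T j) + T i"
proof -
  assume k: "k = 2 * i + 1"
  have "{..<k} = insert 0 ({1..i} \<union> {i+1..2*i})" using k by auto
  moreover have "sum T {i+1..2*i} = sum T {1..i}"
    using assms k by (intro sum.reindex_bij_witness[where i = "\<lambda>r. k - r" and j = "\<lambda>r. k - r"]) auto
  ultimately show "sum T {..<k} = T 0 + 2 * (\<Sum>j = 1..i. T j)"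
    by (simp add: sum.union_disjoint)
next
  assume k: "k = 2 * i" "i \<ge> 1"
  let ?A = "{1..i-1}" and ?B = "{i+1..2*i-1}"
  have "{..<k} = insert 0 (insert i (?A \<union> ?B))" using k by auto
  then have "sum T {..<k} = sum T (insert 0 (insert i (?A \<union> ?B)))" by (simp only:)
  also have "\<dots> = T 0 + (T i + sum T (?A \<union> ?B))"
    using k(2) by (subst sum.insert; (subst sum.insert)?) auto
  also have "sum T (?A \<union> ?B) = sum T ?A + sum T ?B"
    by (rule sum.union_disjoint) auto
  also have "sum T ?B = sum T ?A"
    using assms k by (intro sum.reindex_bij_witness[where i = "\<lambda>r. k - r" and j = "\<lambda>r. k - r"]) auto
  finally show "sum T {..<k} = T 0 + 2 * sum T ?A + T i" by simp
qed

lemma antiperiodic_shift: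
  fixes h :: "real \<Rightarrow> real"
  assumes "\<And>y. h (y + pi) = - h y"
  shows "h (y + of_int b * pi) = (-1) powi b * h y"
proof -
  have nat: "h (y + real n * pi) = (-1) ^ n * h y" for n y
  proof (induction n)
    case (Suc n)
    have "h (y + real (Suc n) * pi) = h ((y + real n * pi) + pi)" by (simp add: algebra_simps)
    then show ?case using assms Suc by simp
  qed simp
  show ?thesis
  proof (cases "b \<ge> 0")
    case True
    then show ?thesis using nat[of y "nat b"] by (simp add: power_int_def)
  next
    case False
    \<comment> \<open>For negative b the natural case is started at the shifted point and leads back
      to y; the sign is its own inverse.\<close>
    have "(-1) ^ nat (- b) * h (y + of_int b * pi) = h y"
      using nat[of "y + of_int b * pi" "nat (- b)"] False by simp
    then have "(-1) ^ nat (- b) * ((-1) ^ nat (- b) * h (y + of_int b * pi)) = (-1) ^ nat (- b) * h y"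
      by simp
    then show ?thesis using False by (simp add: power_int_def)
  qed
qed

text \<open>Treats sine and cosine together: the parity of h matches that of p, so h(nx)/n^p is even
  in n. Since k x = a pi, passing from r to q k + r multiplies the numerator by (-1)^(q (k + a)).
  Hence the class sums are \<open>S_sum\<close> for even k + a and \<open>S_hat\<close> for odd k +
  a.\<close>

lemma trig_series_residues:
  fixes h :: "real \<Rightarrow> real" and k :: nat and a :: int
  assumes p: "p \<ge> 2" and k: "k > 0"
    and shift: "\<And>y. h (y + pi) = - h y" and parity: "\<And>y. h (- y) = (-1) ^ p * h y"
    and bound: "\<And>y. \<bar>h y\<bar> \<le> 1" and x: "real k * x = of_int a * pi"
  defines "S \<equiv> if even (int k + a) then S_sum else S_hat"
  defines "R \<equiv> \<lambda>r. (-1) ^ r * h (real r * x) * S p (int k) (int r)"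
  shows "k = 2 * i + 1 \<Longrightarrow> 2 * (\<Sum>n. (-1) ^ n * h (real n * x) / real n ^ p) = R 0 + 2 * (\<Sum>j = 1..i. R j)"
    and "k = 2 * i \<Longrightarrow> 2 * (\<Sum>n. (-1) ^ n * h (real n * x) / real n ^ p) = R 0 + 2 * (\<Sum>j = 1..i - 1. R j) + R i"
proof -
  define f :: "int \<Rightarrow> real" where "f n = (-1) powi n * h (of_int n * x) / of_int n ^ p" for n
  have even: "f (- n) = f n" for n
    using parity[of "of_int n * x"]
    by (cases "even p") (simp_all add: f_def power_int_minus_one_minus)
  have f_nat: "f (int n) = (-1) ^ n * h (real n * x) / real n ^ p" for n
    by (simp add: f_def)
  have "summable (\<lambda>n. \<bar>f (int n)\<bar>)"
  proof (rule summable_comparison_test'[OF inverse_power_summable[OF p]])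
    show "norm \<bar>f (int n)\<bar> \<le> inverse (real n ^ p)" for n
      unfolding f_nat using bound[of "real n * x"]
      by (simp add: abs_mult divide_inverse mult_left_le_one_le)
  qed
  then have f: "f summable_on UNIV" "infsum f UNIV = 2 * (\<Sum>n. (-1) ^ n * h (real n * x) / real n ^ p)"
    using infsum_int_even[of f] even p by (simp_all add: f_nat) (simp_all add: f_def)
  have R: "(\<Sum>\<^sub>\<infinity>q. f (q * int k + int r)) = R r" for r
  proof -
    have *: "f (q * int k + int r) = (-1) ^ r * h (real r * x) *
        ((if even (int k + a) then 1 else (-1) powi q) / of_int (q * int k + int r) ^ p)" for q
    proof -
      have "of_int (q * int k + int r) * x = real r * x + of_int (q * a) * pi"
        using x by (simp add: algebra_simps)
      then have "h (of_int (q * int k + int r) * x) = (-1) powi (q * a) * h (real r * x)"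
        using antiperiodic_shift[where h = h and y = "real r * x" and b = "q * a", OF shift] by simp
      moreover have "(-1) powi (q * int k + int r) * (-1) powi (q * a) =
          (-1) ^ r * (if even (int k + a) then 1 else (-1::real) powi q)"
        by (auto simp: power_int_minus_left minus_one_power_iff)
      ultimately show ?thesis
        unfolding f_def by (simp only: mult.assoc[symmetric] times_divide_eq_right) simp
    qed
    show ?thesis
      unfolding * infsum_cmult_right' R_def S_def S_sum_def S_hat_def by simp
  qed
  have sum: "infsum f UNIV = sum R {..<k}"
    using infsum_int_residues[OF f(1) k] by (simp add: R)
  have "R (k - r) = R r" if "r < k" for r
    using infsum_residue_reflect[of f "int k" "int r"] even that
    by (simp add: R[symmetric] of_nat_diff)
  note * = sum_reflect_upper[of k R, OF this]
  show "2 * (\<Sum>n. (-1) ^ n * h (real n * x) / real n ^ p) = R 0 + 2 * (\<Sum>j = 1..i. R j)"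
    if "k = 2 * i + 1" using *(1)[OF _ that] sum f(2) by simp
  show "2 * (\<Sum>n. (-1) ^ n * h (real n * x) / real n ^ p) = R 0 + 2 * (\<Sum>j = 1..i - 1. R j) + R i"
    if "k = 2 * i" using *(2)[OF _ that] sum f(2) that k by simp
qed

text \<open>Used to reduce the self-paired class of i modulo 2i to the class of 1 modulo 2.\<close>

lemma S_hat_scale:
  "S_hat p (c * k) (c * l) = S_hat p k l / of_int c ^ p"
proof -
  have "S_hat p (c * k) (c * l) = (\<Sum>\<^sub>\<infinity>j. (1 / of_int c ^ p) * ((-1) powi j / of_int (j * k + l) ^ p))"
    unfolding S_hat_def
  proof (rule infsum_cong)
    fix j :: int
    have "j * (c * k) + c * l = c * (j * k + l)" by (simp add: algebra_simps)
    then show "(-1) powi j / of_int (j * (c * k) + c * l) ^ p = (1 / of_int c ^ p) * ((-1::real) powi j / of_int (j * k + l) ^ p)"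
      by (simp only: of_int_mult power_mult_distrib) simp
  qed
  also have "\<dots> = 1 / of_int c ^ p * S_hat p k l"
    unfolding S_hat_def by (rule infsum_cmult_right')
  finally show ?thesis by simp
qed

lemma S_sum_zero_residue:
  assumes p: "even p" "p > 0" and z: "(\<lambda>n. 1 / real n ^ p) sums z"
  shows "S_sum p k 0 = 2 * z / of_int k ^ p"
proof -
  have "S_sum p k 0 = (\<Sum>\<^sub>\<infinity>j. (1 / of_int k ^ p) * (1 / of_int j ^ p))"
    unfolding S_sum_def by (rule infsum_cong) (simp add: power_mult_distrib)
  also have "\<dots> = (1 / of_int k ^ p) * (\<Sum>\<^sub>\<infinity>j::int. 1 / of_int j ^ p)"
    by (rule infsum_cmult_right')
  also have "(\<Sum>\<^sub>\<infinity>j::int. 1 / real_of_int j ^ p) = 2 * z"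
    using infsum_int_even(2)[of "\<lambda>j. 1 / real_of_int j ^ p"] p z by (auto simp: sums_iff)
  finally show ?thesis by simp
qed

lemma S_hat_zero_residue:
  assumes p: "even p" "p \<ge> 2" and z: "(\<lambda>n. (-1) ^ n / real n ^ p) sums z"
  shows "S_hat p k 0 = 2 * z / of_int k ^ p"
proof -
  have abs: "summable (\<lambda>n. \<bar>(-1) powi (int n) / real_of_int (int n) ^ p\<bar>)"
    using inverse_power_summable[OF p(2), where ?'a = real] by (simp add: inverse_eq_divide)
  have "S_hat p k 0 = (\<Sum>\<^sub>\<infinity>j. (1 / of_int k ^ p) * ((-1) powi j / of_int j ^ p))"
    unfolding S_hat_def by (rule infsum_cong) (simp add: power_mult_distrib)
  also have "\<dots> = (1 / of_int k ^ p) * (\<Sum>\<^sub>\<infinity>j::int. (-1) powi j / of_int j ^ p)"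
    by (rule infsum_cmult_right')
  also have "(\<Sum>\<^sub>\<infinity>j::int. (-1) powi j / real_of_int j ^ p) = 2 * z"
    using infsum_int_even(2)[of "\<lambda>j. (-1) powi j / real_of_int j ^ p", OF _ _ abs] p z
    by (auto simp: sums_iff power_int_minus_one_minus)
  finally show ?thesis by simp
qed

text \<open>The sine series at $\pi/2$, split into residue classes modulo $2$ and modulo $4$.\<close>

lemma S_hat_2_1:
  assumes "odd p" "p \<ge> 2"
  shows "S_hat p 2 1 = 2 * S_sum p 4 1"
proof -
  have parity: "sin (- y) = (-1) ^ p * sin y" for y :: real using assms(1) by simp
  note residues = trig_series_residues(2)[OF assms(2) _ sin_periodic_pi parity abs_sin_le_one]
  define Z where "Z = (\<Sum>n. (-1) ^ n * sin (real n * (pi / 2)) / real n ^ p)"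
  \<comment> \<open>Here k = 2 and a = 1, so k + a is odd; the class of 1 is its own partner, and
    the class of 0 vanishes with sin 0.\<close>
  have "2 * Z = - S_hat p 2 1"
    using residues[of 2 "pi / 2" 1 1] unfolding Z_def[symmetric] by simp
  have x: "0 < (4::nat)" "real 4 * (pi / 2) = real_of_int 2 * pi" "4 = 2 * (2::nat)" "even (int 4 + 2)" "{1..2-1} = {1::nat}"
    "real 1 * (pi / 2) = pi / 2"  "real 2 * (pi / 2) = pi" "real 0 * (pi / 2) = 0"
     by auto
  \<comment> \<open>Here k = 4 and a = 2, so k + a is even; the classes of 1 and 3 are paired, and
    those of 0 and 2 vanish with sin 0 and sin pi.\<close>
  have "2 * Z = - 2 * S_sum p 4 1"
    using residues[OF x(1-3), folded Z_def, unfolded x(5-8)] x(4) by simp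
  then show ?thesis using \<open>2 * Z = - S_hat p 2 1\<close> by simp
qed

section \<open>The series at rational multiples of pi\<close>

lemma alt_cos_residues:
  fixes a :: int
  assumes "even p" "p \<ge> 2" "k > 0" "real k * x = of_int a * pi"
  defines "S \<equiv> if even (int k + a) then S_sum else S_hat"
  shows "k = 2 * i + 1 \<Longrightarrow> alt_cos p x = S p (int k) 0 / 2
      + (\<Sum>j = 1..i. (-1) ^ j * cos (real j * x) * S p (int k) (int j))"
    and "k = 2 * i \<Longrightarrow> alt_cos p x = S p (int k) 0 / 2
      + (\<Sum>j = 1..i - 1. (-1) ^ j * cos (real j * x) * S p (int k) (int j))
      + (-1) ^ i * cos (real i * x) * S p (int k) (int i) / 2"
proof -
  have parity: "cos (- y) = (-1) ^ p * cos y" for y :: real using assms(1) by simp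
  note residues = trig_series_residues[OF assms(2,3) cos_periodic_pi parity abs_cos_le_one assms(4),
      folded S_def alt_cos_def]
  show "alt_cos p x = S p (int k) 0 / 2
      + (\<Sum>j = 1..i. (-1) ^ j * cos (real j * x) * S p (int k) (int j))" if "k = 2 * i + 1"
    using residues(1)[OF that] by simp
  show "alt_cos p x = S p (int k) 0 / 2
      + (\<Sum>j = 1..i - 1. (-1) ^ j * cos (real j * x) * S p (int k) (int j))
      + (-1) ^ i * cos (real i * x) * S p (int k) (int i) / 2" if "k = 2 * i"
    using residues(2)[OF that] by simp
qed

text \<open>In contrast to the cosine case, the class of 0 drops out because sin 0 = 0.\<close>

lemma alt_sin_residues:
  fixes a :: int
  assumes "odd p" "p \<ge> 2" "k > 0" "real k * x = of_int a * pi"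
  defines "S \<equiv> if even (int k + a) then S_sum else S_hat"
  shows "k = 2 * i + 1 \<Longrightarrow> alt_sin p x = (\<Sum>j = 1..i. (-1) ^ j * sin (real j * x) * S p (int k) (int j))"
    and "k = 2 * i \<Longrightarrow> alt_sin p x = (\<Sum>j = 1..i - 1. (-1) ^ j * sin (real j * x) * S p (int k) (int j))
      + (-1) ^ i * sin (real i * x) * S p (int k) (int i) / 2"
proof -
  have parity: "sin (- y) = (-1) ^ p * sin y" for y :: real using assms(1) by simp
  note residues = trig_series_residues[OF assms(2,3) sin_periodic_pi parity abs_sin_le_one assms(4),
      folded S_def alt_sin_def]
  show "alt_sin p x = (\<Sum>j = 1..i. (-1) ^ j * sin (real j * x) * S p (int k) (int j))" if "k = 2 * i + 1"
    using residues(1)[OF that] by simp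
  show "alt_sin p x = (\<Sum>j = 1..i - 1. (-1) ^ j * sin (real j * x) * S p (int k) (int j))
      + (-1) ^ i * sin (real i * x) * S p (int k) (int i) / 2" if "k = 2 * i"
    using residues(2)[OF that] by simp
qed

lemma S_hat_zero_residue_alt_cos:
  assumes "even p" "p \<ge> 2"
  shows "S_hat p k 0 = 2 * alt_cos p 0 / of_int k ^ p"
  using alt_cos_sums[of p 0] assms by (intro S_hat_zero_residue) auto

lemma pi_fraction_bounds:
  fixes u v :: real
  assumes "0 \<le> u" "u < v"
  shows "0 \<le> u * pi / v" and "u * pi / v < pi"
  using assms by (simp_all add: pos_divide_less_eq mult.commute)

theorem theorem1:
  fixes i :: nat
  assumes "i \<ge> 1"
  shows
    "(\<forall>m::nat. \<forall>l\<in>{1..i}.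
        c_poly m ((2 * real l - 1) * pi / (2 * real i + 1)) =
          (-1) ^ m * bernoulli (2 * m + 2) * pi ^ (2 * m + 2) / fact (2 * m + 2) *
            (2 ^ (2 * m + 1) * (1 + 1 / (2 * real i + 1) ^ (2 * m + 2)) - 1) +
          (\<Sum>j = 1..i. (-1) ^ j * cos (real j * (2 * real l - 1) * pi / (2 * real i + 1)) *
             S_sum (2 * m + 2) (2 * int i + 1) (int j)))
     \<and> (\<forall>m::nat. \<forall>l\<in>{1..i}.
        c_poly m ((2 * real l - 1) * pi / (2 * real i)) =
          pi ^ (2 * m + 2) * (-1) ^ m * bernoulli (2 * m + 2) * (2 ^ (2 * m + 1) - 1) /
            fact (2 * m + 2) * (1 - 1 / (2 * real i) ^ (2 * m + 2)) +
          (\<Sum>j = 1..i - 1. (-1) ^ j * cos ((2 * real l - 1) * real j * pi / (2 * real i)) *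
             S_hat (2 * m + 2) (2 * int i) (int j)))
     \<and> (\<forall>m::nat. \<forall>l\<in>{1..i}.
        c_poly m (2 * real l * pi / (2 * real i + 1)) =
          pi ^ (2 * m + 2) * (-1) ^ m * bernoulli (2 * m + 2) * (2 ^ (2 * m + 1) - 1) /
            fact (2 * m + 2) * (1 - 1 / (2 * real i + 1) ^ (2 * m + 2)) +
          (\<Sum>j = 1..i. (-1) ^ j * cos (2 * real l * real j * pi / (2 * real i + 1)) *
             S_hat (2 * m + 2) (2 * int i + 1) (int j)))
     \<and> (\<forall>m::nat. m \<ge> 1 \<longrightarrow> (\<forall>l\<in>{1..i}.
        s_poly m ((2 * real l - 1) * pi / (2 * real i + 1)) =
          (\<Sum>j = 1..i. (-1) ^ j * sin ((2 * real l - 1) * real j * pi / (2 * real i + 1)) *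
             S_sum (2 * m + 1) (2 * int i + 1) (int j))))
     \<and> (\<forall>m::nat. m \<ge> 1 \<longrightarrow> (\<forall>l\<in>{1..i}.
        s_poly m ((2 * real l - 1) * pi / (2 * real i)) =
          (-1) ^ (i + l + 1) * (1 / real i ^ (2 * m + 1)) * S_sum (2 * m + 1) 4 1 +
          (\<Sum>j = 1..i - 1. (-1) ^ j * sin ((2 * real l - 1) * real j * pi / (2 * real i)) *
             S_hat (2 * m + 1) (2 * int i) (int j))))
     \<and> (\<forall>m::nat. m \<ge> 1 \<longrightarrow> (\<forall>l\<in>{1..i}.
        s_poly m (2 * real l * pi / (2 * real i + 1)) =
          (\<Sum>j = 1..i. (-1) ^ j * sin (2 * real l * real j * pi / (2 * real i + 1)) *
             S_hat (2 * m + 1) (2 * int i + 1) (int j))))"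
proof (intro conjI allI impI ballI)
  fix m l :: nat assume l: "l \<in> {1..i}"
  let ?p = "2 * m + 2" and ?x = "(2 * real l - 1) * pi / (2 * real i + 1)"
  define A where "A = (-1) ^ m * bernoulli ?p * pi ^ ?p / fact ?p"
  define t :: real where "t = 2 ^ (2 * m + 1)"
  define D where "D = (2 * real i + 1) ^ ?p"
  \<comment> \<open>With k = 2i + 1 and a = 2l - 1 the sum k + a is even, which selects
    \<open>S_sum\<close>; the same choice recurs for the sine series at these points.\<close>
  have x: "real (2 * i + 1) * ?x = of_int (2 * int l - 1) * pi" by (simp add: field_simps)
  have angle: "real j * ?x = real j * (2 * real l - 1) * pi / (2 * real i + 1)" for j by simp
  have x_range: "0 \<le> ?x" "?x < pi" by (rule pi_fraction_bounds; use l in simp)+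
  have "c_poly m ?x = alt_cos ?p ?x - alt_cos ?p 0"
    by (rule c_poly_eq_alt_cos[OF x_range])
  also have "alt_cos ?p ?x = S_sum ?p (2 * int i + 1) 0 / 2 +
      (\<Sum>j = 1..i. (-1) ^ j * cos (real j * ?x) * S_sum ?p (2 * int i + 1) (int j))"
    using alt_cos_residues(1)[OF _ _ _ x, of ?p i] by (simp add: ac_simps)
  \<comment> \<open>Half the class of 0 is the zeta value \<open>A * t\<close> divided by
    \<open>D\<close>. Together with \<open>A * (t - 1)\<close> from the value at 0 it forms the
    Bernoulli term.\<close>
  also have "S_sum ?p (2 * int i + 1) 0 = 2 * (A * t) / D"
    using S_sum_zero_residue[OF _ _ inverse_even_powers_sums, of m "2 * int i + 1"]
    unfolding A_def t_def D_def by simp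
  also have "alt_cos ?p 0 = - (A * (t - 1))"
    unfolding A_def t_def alt_cos_at_0 by (simp del: fact_Suc power_Suc)
  finally have "c_poly m ?x = A * (t * (1 + 1 / D) - 1) +
      (\<Sum>j = 1..i. (-1) ^ j * cos (real j * ?x) * S_sum ?p (2 * int i + 1) (int j))"
    by (simp add: algebra_simps)
  then show "c_poly m ?x = (-1) ^ m * bernoulli ?p * pi ^ ?p / fact ?p *
        (2 ^ (2 * m + 1) * (1 + 1 / (2 * real i + 1) ^ ?p) - 1) +
      (\<Sum>j = 1..i. (-1) ^ j * cos (real j * (2 * real l - 1) * pi / (2 * real i + 1)) *
         S_sum ?p (2 * int i + 1) (int j))"
    unfolding A_def t_def D_def angle .
next
  fix m l :: nat assume l: "l \<in> {1..i}"
  let ?p = "2 * m + 2" and ?x = "(2 * real l - 1) * pi / (2 * real i)"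
  \<comment> \<open>With k = 2i and a = 2l - 1 the sum k + a is odd, which selects
    \<open>S_hat\<close>.\<close>
  have x: "real (2 * i) * ?x = of_int (2 * int l - 1) * pi" using assms by (simp add: field_simps)
  have angle: "real j * ?x = (2 * real l - 1) * real j * pi / (2 * real i)" for j by simp
  have x_range: "0 \<le> ?x" "?x < pi" by (rule pi_fraction_bounds; use l in simp)+
  \<comment> \<open>The self-paired class of i sits at an odd multiple of pi/2 and drops
    out.\<close>
  have mid: "cos (real i * ?x) = 0"
  proof -
    have "real i * ?x = pi / 2 + of_int (int l - 1) * pi" using assms by (simp add: field_simps)
    then show ?thesis using antiperiodic_shift[of cos "pi / 2" "int l - 1", OF cos_periodic_pi] by simp
  qed
  have "c_poly m ?x = alt_cos ?p ?x - alt_cos ?p 0"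
    by (rule c_poly_eq_alt_cos[OF x_range])
  also have "alt_cos ?p ?x = S_hat ?p (2 * int i) 0 / 2 +
      (\<Sum>j = 1..i - 1. (-1) ^ j * cos (real j * ?x) * S_hat ?p (2 * int i) (int j))"
    using alt_cos_residues(2)[OF _ _ _ x, of ?p i] assms unfolding mid by simp
  \<comment> \<open>The class of 0 now alternates, so it is a multiple of the same
    \<open>alt_cos ?p 0\<close> that is subtracted; only a common factor remains.\<close>
  also have "S_hat ?p (2 * int i) 0 = 2 * alt_cos ?p 0 / (2 * real i) ^ ?p"
    using S_hat_zero_residue_alt_cos[of ?p "2 * int i"] by simp
  finally have "c_poly m ?x = - alt_cos ?p 0 * (1 - 1 / (2 * real i) ^ ?p) +
      (\<Sum>j = 1..i - 1. (-1) ^ j * cos (real j * ?x) * S_hat ?p (2 * int i) (int j))"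
    by (simp add: right_diff_distrib)
  then show "c_poly m ?x =
      pi ^ ?p * (-1) ^ m * bernoulli ?p * (2 ^ (2 * m + 1) - 1) / fact ?p * (1 - 1 / (2 * real i) ^ ?p) +
      (\<Sum>j = 1..i - 1. (-1) ^ j * cos ((2 * real l - 1) * real j * pi / (2 * real i)) *
         S_hat ?p (2 * int i) (int j))"
    unfolding alt_cos_at_0 minus_minus angle .
next
  fix m l :: nat assume l: "l \<in> {1..i}"
  let ?p = "2 * m + 2" and ?x = "2 * real l * pi / (2 * real i + 1)"
  \<comment> \<open>With k = 2i + 1 and a = 2l the sum k + a is odd, which again selects
    \<open>S_hat\<close>.\<close>
  have x: "real (2 * i + 1) * ?x = of_int (2 * int l) * pi" by (simp add: field_simps)
  have angle: "real j * ?x = 2 * real l * real j * pi / (2 * real i + 1)" for j by simp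
  have x_range: "0 \<le> ?x" "?x < pi" by (rule pi_fraction_bounds; use l in simp)+
  have "c_poly m ?x = alt_cos ?p ?x - alt_cos ?p 0"
    by (rule c_poly_eq_alt_cos[OF x_range])
  also have "alt_cos ?p ?x = S_hat ?p (2 * int i + 1) 0 / 2 +
      (\<Sum>j = 1..i. (-1) ^ j * cos (real j * ?x) * S_hat ?p (2 * int i + 1) (int j))"
    using alt_cos_residues(1)[OF _ _ _ x, of ?p i] by (simp add: ac_simps)
  also have "S_hat ?p (2 * int i + 1) 0 = 2 * alt_cos ?p 0 / (2 * real i + 1) ^ ?p"
    using S_hat_zero_residue_alt_cos[of ?p "2 * int i + 1"] by simp
  finally have "c_poly m ?x = - alt_cos ?p 0 * (1 - 1 / (2 * real i + 1) ^ ?p) +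
      (\<Sum>j = 1..i. (-1) ^ j * cos (real j * ?x) * S_hat ?p (2 * int i + 1) (int j))"
    by (simp add: right_diff_distrib)
  then show "c_poly m ?x =
      pi ^ ?p * (-1) ^ m * bernoulli ?p * (2 ^ (2 * m + 1) - 1) / fact ?p * (1 - 1 / (2 * real i + 1) ^ ?p) +
      (\<Sum>j = 1..i. (-1) ^ j * cos (2 * real l * real j * pi / (2 * real i + 1)) *
         S_hat ?p (2 * int i + 1) (int j))"
    unfolding alt_cos_at_0 minus_minus angle .
next
  fix m l :: nat assume m: "m \<ge> 1" and l: "l \<in> {1..i}"
  let ?p = "2 * m + 1" and ?x = "(2 * real l - 1) * pi / (2 * real i + 1)"
  have x: "real (2 * i + 1) * ?x = of_int (2 * int l - 1) * pi" by (simp add: field_simps)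
  have x_range: "0 \<le> ?x" "?x < pi" by (rule pi_fraction_bounds; use l in simp)+
  have "s_poly m ?x = alt_sin ?p ?x"
    by (rule s_poly_eq_alt_sin[OF m x_range])
  also have "\<dots> = (\<Sum>j = 1..i. (-1) ^ j * sin (real j * ?x) * S_sum ?p (2 * int i + 1) (int j))"
    using alt_sin_residues(1)[OF _ _ _ x, of ?p i] m by (simp add: ac_simps)
  finally show "s_poly m ?x = (\<Sum>j = 1..i. (-1) ^ j *
      sin ((2 * real l - 1) * real j * pi / (2 * real i + 1)) * S_sum ?p (2 * int i + 1) (int j))"
    by (simp add: ac_simps)
next
  fix m l :: nat assume m: "m \<ge> 1" and l: "l \<in> {1..i}"
  let ?p = "2 * m + 1" and ?x = "(2 * real l - 1) * pi / (2 * real i)"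
  have x: "real (2 * i) * ?x = of_int (2 * int l - 1) * pi" using assms by (simp add: field_simps)
  have x_range: "0 \<le> ?x" "?x < pi" by (rule pi_fraction_bounds; use l in simp)+
  \<comment> \<open>For the sine the self-paired class survives, as the sine at an odd multiple of
    pi/2 is a sign.\<close>
  have mid: "(-1) ^ i * sin (real i * ?x) = (-1) ^ (i + l + 1)"
  proof -
    have "real i * ?x = pi / 2 + of_int (int l - 1) * pi" using assms by (simp add: field_simps)
    then have "sin (real i * ?x) = (-1) powi (int l - 1)"
      using antiperiodic_shift[of sin "pi / 2" "int l - 1", OF sin_periodic_pi] by simp
    then show ?thesis by (simp add: power_int_minus_left minus_one_power_iff)
  qed
  \<comment> \<open>The factor 2 offsets the weight 1/2 of the self-paired class.\<close>
  have S: "S_hat ?p (2 * int i) (int i) = 2 * S_sum ?p 4 1 / real i ^ ?p"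
    using S_hat_scale[of ?p "int i" 2 1] S_hat_2_1[of ?p] m by (simp add: mult.commute)
  have "s_poly m ?x = alt_sin ?p ?x"
    by (rule s_poly_eq_alt_sin[OF m x_range])
  also have "\<dots> = (\<Sum>j = 1..i - 1. (-1) ^ j * sin (real j * ?x) * S_hat ?p (2 * int i) (int j)) +
      (-1) ^ (i + l + 1) * S_hat ?p (2 * int i) (int i) / 2"
    using alt_sin_residues(2)[OF _ _ _ x, of ?p i] assms m unfolding mid by simp
  also note S
  finally show "s_poly m ?x = (-1) ^ (i + l + 1) * (1 / real i ^ ?p) * S_sum ?p 4 1 +
      (\<Sum>j = 1..i - 1. (-1) ^ j * sin ((2 * real l - 1) * real j * pi / (2 * real i)) *
         S_hat ?p (2 * int i) (int j))"
    by (simp add: ac_simps)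
next
  fix m l :: nat assume m: "m \<ge> 1" and l: "l \<in> {1..i}"
  let ?p = "2 * m + 1" and ?x = "2 * real l * pi / (2 * real i + 1)"
  have x: "real (2 * i + 1) * ?x = of_int (2 * int l) * pi" by (simp add: field_simps)
  have x_range: "0 \<le> ?x" "?x < pi" by (rule pi_fraction_bounds; use l in simp)+
  have "s_poly m ?x = alt_sin ?p ?x"
    by (rule s_poly_eq_alt_sin[OF m x_range])
  also have "\<dots> = (\<Sum>j = 1..i. (-1) ^ j * sin (real j * ?x) * S_hat ?p (2 * int i + 1) (int j))"
    using alt_sin_residues(1)[OF _ _ _ x, of ?p i] m by (simp add: ac_simps)
  finally show "s_poly m ?x = (\<Sum>j = 1..i. (-1) ^ j *
      sin (2 * real l * real j * pi / (2 * real i + 1)) * S_hat ?p (2 * int i + 1) (int j))"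
    by (simp add: ac_simps)
qed

end
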